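(* Let $N\ge 1$ and let $g \in \mathbb{C}^N$ be a vector such that $\langle g, g_\lambda\rangle \neq 0$ for every $\lambda \in \mathbb{Z}_N^2$. Then the Gabor frame $G=(g_\lambda)_{\lambda\in\mathbb{Z}_N^2}$ allows phase retrieval (for $\mathbb{C}^N$).
   Context: Vectors in $\mathbb{C}^N$ are indexed by $\mathbb{Z}_N=\mathbb{Z}/N\mathbb{Z}$, and $\omega=e^{2\pi i/N}$. The scalar product is $\langle x,y\rangle=\sum_{j\in\mathbb{Z}_N}\overline{x(j)}\,y(j)$. Translations and modulations are $(T_px)(n)=x(n-p)$ and $(M_\ell x)(n)=\omega^{\ell n}x(n)$ for $p,\ell\in\mathbb{Z}_N$. For $\lambda=(p,\ell)\in\mathbb{Z}_N^2$ put $\Pi_\lambda=M_\ell T_p$ and $g_\lambda=g_{p,\ell}=\Pi_\lambda g$. Let $\mathbb{T}=\{c\in\mathbb{C}:|c|=1\}$. For a class $\mathcal{C}\subseteq\mathbb{C}^N$ and $\Lambda\subseteq\mathbb{Z}_N^2$, the system $(g_\lambda)_{\lambda\in\Lambda}$ allows phase retrieval for $\mathcal{C}$ if the map $x\mapsto(|\langle x,g_\lambda\rangle|^2)_{\lambda\in\Lambda}$ is injective on $\mathcal{C}/\mathbb{T}$; i.e. whenever $x,y\in\mathcal{C}$ satisfy $|\langle x,g_\lambda\rangle|=|\langle y,g_\lambda\rangle|$ for all $\lambda\in\Lambda$, there is $c\in\mathbb{T}$ with $x=cy$. "Allows phase retrieval" without further specification means for $\mathcal{C}=\mathbb{C}^N$.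 *)

theory Defs
  imports "HOL-Analysis.Analysis" "Berlekamp_Zassenhaus.Finite_Field"
begin

text \<open>
  The ring \<open>\<int>/N\<int>\<close> is \<open>'n mod_ring\<close> with \<open>N = CARD('n)\<close>, for an arbitrary finite type \<open>'n\<close>
  (so \<open>N \<ge> 1\<close> is arbitrary), and \<open>\<complex>\<^sup>N\<close> is \<open>complex ^ 'n mod_ring\<close>, i.e. vectors indexed by \<open>\<int>/N\<int>\<close>.
\<close>

text \<open>Conjugate-linear in the first argument.\<close>

definition scalar_prod :: "complex ^ 'i::finite \<Rightarrow> complex ^ 'i \<Rightarrow> complex" where
  "scalar_prod x y = (\<Sum>j\<in>UNIV. cnj (x $ j) * y $ j)"

text \<open>\<open>root_char k\<close> is \<open>\<omega>\<^sup>k\<close> with \<open>\<omega> = exp (2\<pi>\<i>/N)\<close>; the exponent is the representative of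
  \<open>k\<close> in \<open>{0..<N}\<close>, the choice being immaterial as \<open>\<omega>\<close> is an \<open>N\<close>-th root of unity.\<close>

definition root_char :: "'n::finite mod_ring \<Rightarrow> complex" where
  "root_char k = exp (2 * of_real pi * \<i> / of_nat CARD('n)) powi to_int_mod_ring k"

definition translation ::
    "'n::finite mod_ring \<Rightarrow> complex ^ 'n mod_ring \<Rightarrow> complex ^ 'n mod_ring" where
  "translation p x = (\<chi> n. x $ (n - p))"

definition modulation ::
    "'n::finite mod_ring \<Rightarrow> complex ^ 'n mod_ring \<Rightarrow> complex ^ 'n mod_ring" where
  "modulation l x = (\<chi> n. root_char (l * n) * x $ n)"

definition tf_shift ::
    "'n::finite mod_ring \<times> 'n mod_ring \<Rightarrow> complex ^ 'n mod_ring \<Rightarrow> complex ^ 'n mod_ring" where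
  "tf_shift \<mu> x = (case \<mu> of (p, l) \<Rightarrow> modulation l (translation p x))"

definition gabor ::
    "complex ^ 'n mod_ring \<Rightarrow> 'n::finite mod_ring \<times> 'n mod_ring \<Rightarrow> complex ^ 'n mod_ring" where
  "gabor g \<mu> = tf_shift \<mu> g"

text \<open>Injectivity of \<open>x \<mapsto> (|\<langle>x, f\<^sub>\<mu>\<rangle>|\<^sup>2)\<^sub>\<mu>\<close> on \<open>C\<close> up to a unimodular factor.\<close>

definition allows_phase_retrieval ::
    "(complex ^ 'i::finite) set \<Rightarrow> 'l set \<Rightarrow> ('l \<Rightarrow> complex ^ 'i) \<Rightarrow> bool" where
  "allows_phase_retrieval C \<Lambda> f \<longleftrightarrow>
     (\<forall>x\<in>C. \<forall>y\<in>C.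
        (\<forall>\<mu>\<in>\<Lambda>. (cmod (scalar_prod x (f \<mu>)))\<^sup>2 = (cmod (scalar_prod y (f \<mu>)))\<^sup>2) \<longrightarrow>
        (\<exists>c. cmod c = 1 \<and> x = c *s y))"

end

theory Submission
  imports Defs
begin

text \<open>
  The measurements determine the rank-one matrix \<open>x k * cnj (x j)\<close>, hence \<open>x\<close> up to a phase
  (\<open>rank_one_determines_vector\<close>). To see this, write the matrix in terms of its
  diagonals \<open>h q k = x k * cnj (x (k + q))\<close>, and put \<open>G q r = cnj (g r) * g (r + q)\<close>. Expanding the
  square gives (\<open>cmod_scalar_prod_gabor_square\<close>)

    \<open>|\<langle>x, g\<^bsub>p,l\<^esub>\<rangle>|\<^sup>2 = \<Sum>\<^sub>q \<omega>\<^bsup>l q\<^esup> \<Sum>\<^sub>k h q k * G q (k - p)\<close>.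

  Since the finite Fourier transform is injective, letting \<open>l\<close> vary recovers the inner sum for every
  \<open>q\<close> and \<open>p\<close>. For fixed \<open>q\<close> this inner sum is the cross-correlation of \<open>h q\<close> with \<open>G q\<close>, which
  determines \<open>h q\<close> if the Fourier transform of \<open>G q\<close> vanishes nowhere
  (\<open>cross_correlation_injective\<close>). That transform at \<open>m\<close> is \<open>\<langle>g, g\<^bsub>-q,m\<^esub>\<rangle>\<close>, nonzero by the
  hypothesis on \<open>g\<close>. As every step is linear in \<open>h\<close>, two vectors with the
  same measurements are compared through the difference of their diagonals.
\<close>

lemma root_char_eq_exp:
  "root_char (k :: 'n::finite mod_ring) =
     exp (of_int (to_int_mod_ring k) * (2 * of_real pi * \<i> / of_nat CARD('n)))"
  by (simp only: root_char_def exp_power_int)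

lemma root_char_eq_1_iff:
  fixes k :: "'n::finite mod_ring"
  shows "root_char k = 1 \<longleftrightarrow> k = 0"
proof
  assume "root_char k = 1"
  then obtain m :: int where "2 * pi * of_int (to_int_mod_ring k) / of_nat CARD('n) = of_int (2 * m) * pi"
    unfolding root_char_eq_exp exp_eq_1 by (auto simp: mult_ac)
  then have "real_of_int (to_int_mod_ring k) = of_int (m * int CARD('n))"
    by (simp add: field_simps)
  then have eq: "to_int_mod_ring k = m * int CARD('n)"
    by (simp only: of_int_eq_iff)
  have "0 \<le> to_int_mod_ring k" "to_int_mod_ring k < int CARD('n)"
    using range_to_int_mod_ring[where 'a = 'n] by auto
  then have "to_int_mod_ring k = to_int_mod_ring k mod int CARD('n)"
    by simp
  also have "\<dots> = 0"
    by (simp add: eq)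
  finally show "k = 0"
    by simp
qed (simp add: root_char_def)

text \<open>Representatives add only modulo \<open>N\<close>; the powers of \<open>\<omega>\<close> do not see this because
  \<open>\<omega>\<^sup>N = 1\<close>.\<close>

lemma root_char_add:
  fixes a b :: "'n::finite mod_ring"
  shows "root_char (a + b) = root_char a * root_char b"
proof -
  define w :: complex where "w = exp (2 * of_real pi * \<i> / of_nat CARD('n))"
  have w0: "w \<noteq> 0"
    by (simp add: w_def)
  have "w powi int CARD('n) = 1"
    unfolding w_def exp_power_int by (simp add: exp_eq_1)
  then have w1: "w powi (int CARD('n) * m) = 1" for m
    by (simp add: power_int_mult)
  have periodic: "w powi (z mod int CARD('n)) = w powi z" for z
  proof -
    have "w powi z = w powi (int CARD('n) * (z div int CARD('n)) + z mod int CARD('n))"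
      by simp
    also have "\<dots> = w powi (z mod int CARD('n))"
      unfolding power_int_add[OF disjI1[OF w0]] w1 by simp
    finally show ?thesis ..
  qed
  have "to_int_mod_ring (a + b) = (to_int_mod_ring a + to_int_mod_ring b) mod int CARD('n)"
    by transfer simp
  then show ?thesis
    using w0 by (simp add: root_char_def periodic power_int_add flip: w_def)
qed

lemma root_char_0 [simp]: "root_char 0 = 1"
  by (simp add: root_char_eq_1_iff)

lemma root_char_diff: "root_char (a - b) = root_char a * root_char (- b)"
  by (simp flip: root_char_add)

lemma cnj_root_char: "cnj (root_char k) = root_char (- k)"
proof -
  have "root_char k * root_char (- k) = 1"
    by (simp flip: root_char_add)
  moreover have "root_char k * cnj (root_char k) = 1"
    by (simp add: root_char_eq_exp exp_cnj flip: exp_add)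
  ultimately show ?thesis
    by (metis mult_cancel_left mult_zero_left zero_neq_one)
qed

lemma sum_UNIV_translate:
  fixes f :: "'a::{finite,ab_group_add} \<Rightarrow> 'b::comm_monoid_add"
  shows "(\<Sum>k\<in>UNIV. f (k + a)) = (\<Sum>k\<in>UNIV. f k)"
  by (rule sum.reindex_bij_witness[where i = "\<lambda>k. k - a" and j = "\<lambda>k. k + a"]) auto

text \<open>Multiplying the sum by one of its terms only permutes the terms, so a nonzero value forces
  all of them to be \<open>1\<close>. The factor \<open>t\<close> below stands for the unit of \<open>\<int>/N\<int>\<close>; going
  through the representative \<open>1\<close> covers \<open>N = 1\<close>, where the ring is trivial.\<close>

lemma root_char_orthogonality:
  fixes k :: "'n::finite mod_ring"
  shows "(\<Sum>l\<in>UNIV. root_char (l * k)) = (if k = 0 then of_nat CARD('n) else 0)"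
proof (cases "k = 0")
  case False
  define t :: "'n mod_ring" where "t = of_int_mod_ring 1"
  have "t * k = k"
    unfolding t_def by transfer (auto simp: mod_simps)
  then have "(\<Sum>l\<in>UNIV. root_char (l * k)) * root_char k = (\<Sum>l\<in>UNIV. root_char ((l + t) * k))"
    by (simp add: sum_distrib_right distrib_right root_char_add)
  also have "\<dots> = (\<Sum>l\<in>UNIV. root_char (l * k))"
    by (rule sum_UNIV_translate)
  finally show ?thesis
    using False by (simp add: root_char_eq_1_iff)
qed simp

text \<open>Orthogonality inverts the transform: summing against the conjugate character
  at \<open>k\<close> returns \<open>N * d k\<close>.\<close>

lemma fourier_injective:
  fixes d :: "'n::finite mod_ring \<Rightarrow> complex"
  assumes "\<And>l. (\<Sum>k\<in>UNIV. root_char (l * k) * d k) = 0"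
  shows "d k = 0"
proof -
  have "0 = (\<Sum>l\<in>UNIV. root_char (- (l * k)) * (\<Sum>j\<in>UNIV. root_char (l * j) * d j))"
    by (simp add: assms)
  also have "\<dots> = (\<Sum>l\<in>UNIV. \<Sum>j\<in>UNIV. root_char (l * (j - k)) * d j)"
    by (simp add: sum_distrib_left right_diff_distrib root_char_diff mult_ac)
  also have "\<dots> = (\<Sum>j\<in>UNIV. (\<Sum>l\<in>UNIV. root_char (l * (j - k))) * d j)"
    by (subst sum.swap) (simp add: sum_distrib_right)
  also have "\<dots> = (\<Sum>j\<in>UNIV. if j = k then of_nat CARD('n) * d j else 0)"
    by (intro sum.cong) (auto simp: root_char_orthogonality)
  also have "\<dots> = of_nat CARD('n) * d k"
    by simp
  finally show ?thesis
    by simp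
qed

lemma scalar_prod_gabor:
  "scalar_prod x (gabor g (p, l)) = (\<Sum>j\<in>UNIV. cnj (x $ j) * (root_char (l * j) * g $ (j - p)))"
  by (simp add: scalar_prod_def gabor_def tf_shift_def modulation_def translation_def)

text \<open>Expanding the square as a double sum over \<open>j\<close> and \<open>k\<close>, the modulation parameter \<open>l\<close> enters only
  through the difference \<open>q = j - k\<close>; grouping by \<open>q\<close> exhibits the measurements, for fixed
  \<open>p\<close>, as a Fourier transform in \<open>q\<close>.\<close>

lemma cmod_scalar_prod_gabor_square:
  fixes x g :: "complex ^ 'n::finite mod_ring"
  shows "of_real ((cmod (scalar_prod x (gabor g (p, l))))\<^sup>2) =
    (\<Sum>q\<in>UNIV. root_char (l * q) *
      (\<Sum>k\<in>UNIV. x $ k * cnj (x $ (k + q)) * (cnj (g $ (k - p)) * g $ (k - p + q))))"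
proof -
  define F where "F j k = root_char (l * (j - k)) *
      (x $ k * cnj (x $ j) * (cnj (g $ (k - p)) * g $ (j - p)))" for j k
  have "of_real ((cmod (scalar_prod x (gabor g (p, l))))\<^sup>2) = (\<Sum>j\<in>UNIV. \<Sum>k\<in>UNIV. F j k)"
    by (simp only: complex_norm_square scalar_prod_gabor cnj_sum sum_product)
       (simp add: F_def cnj_root_char right_diff_distrib root_char_diff mult_ac)
  also have "\<dots> = (\<Sum>k\<in>UNIV. \<Sum>j\<in>UNIV. F j k)"
    by (rule sum.swap)
  also have "\<dots> = (\<Sum>k\<in>UNIV. \<Sum>q\<in>UNIV. F (q + k) k)"
    by (intro sum.cong refl sum_UNIV_translate[symmetric])
  also have "\<dots> = (\<Sum>q\<in>UNIV. \<Sum>k\<in>UNIV. F (q + k) k)"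
    by (rule sum.swap)
  finally show ?thesis
    by (simp add: F_def sum_distrib_left algebra_simps)
qed

text \<open>A cross-correlation becomes a product under the Fourier transform, so it determines
  \<open>d\<close> as soon as the transform of \<open>G\<close> has no zeros.\<close>

lemma cross_correlation_injective:
  fixes d G :: "'n::finite mod_ring \<Rightarrow> complex"
  assumes zero: "\<And>p. (\<Sum>k\<in>UNIV. d k * G (k - p)) = 0"
    and nz: "\<And>m. (\<Sum>r\<in>UNIV. root_char (m * r) * G r) \<noteq> 0"
  shows "d k = 0"
proof (rule fourier_injective)
  fix l :: "'n mod_ring"
  have G: "(\<Sum>p\<in>UNIV. root_char (l * p) * G (k - p)) =
      root_char (l * k) * (\<Sum>r\<in>UNIV. root_char ((- l) * r) * G r)" for k
  proof -
    have "(\<Sum>p\<in>UNIV. root_char (l * p) * G (k - p)) = (\<Sum>r\<in>UNIV. root_char (l * (k - r)) * G r)"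
      by (rule sum.reindex_bij_witness[where i = "\<lambda>r. k - r" and j = "\<lambda>p. k - p"]) auto
    then show ?thesis
      by (simp add: sum_distrib_left right_diff_distrib root_char_diff mult_ac)
  qed
  have "0 = (\<Sum>p\<in>UNIV. root_char (l * p) * (\<Sum>k\<in>UNIV. d k * G (k - p)))"
    by (simp add: zero)
  also have "\<dots> = (\<Sum>k\<in>UNIV. \<Sum>p\<in>UNIV. d k * (root_char (l * p) * G (k - p)))"
    by (subst sum.swap) (simp add: sum_distrib_left mult_ac)
  also have "\<dots> = (\<Sum>k\<in>UNIV. root_char (l * k) * d k) * (\<Sum>r\<in>UNIV. root_char ((- l) * r) * G r)"
    by (simp only: G flip: sum_distrib_left) (simp add: sum_distrib_right mult_ac)
  finally show "(\<Sum>k\<in>UNIV. root_char (l * k) * d k) = 0"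
    using nz[of "- l"] by simp
qed

text \<open>If \<open>x j \<noteq> 0\<close>, comparing column \<open>j\<close> of the two matrices gives
  \<open>cnj (x j) x = cnj (y j) y\<close>, and the diagonal entries give \<open>|x j| = |y j|\<close>, which makes
  the quotient of the two scalars unimodular.\<close>

lemma rank_one_determines_vector:
  fixes x y :: "complex ^ 'i::finite"
  assumes eq: "\<And>j k. x $ k * cnj (x $ j) = y $ k * cnj (y $ j)"
  shows "\<exists>c. cmod c = 1 \<and> x = c *s y"
proof (cases "x = 0")
  case True
  have "y $ j = 0" for j
    using eq[of j j] True by simp
  then show ?thesis
    using True by (intro exI[of _ 1]) (simp add: vec_eq_iff)
next
  case False
  then obtain j where j: "x $ j \<noteq> 0"
    by (auto simp: vec_eq_iff)
  have "of_real ((cmod (x $ j))\<^sup>2) = (of_real ((cmod (y $ j))\<^sup>2) :: complex)"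
    unfolding complex_norm_square by (rule eq)
  then have norm: "cmod (x $ j) = cmod (y $ j)"
    by (simp only: of_real_eq_iff) simp
  define c where "c = cnj (y $ j) / cnj (x $ j)"
  have "cmod c = 1"
    using j norm by (auto simp: c_def norm_divide)
  moreover have "x $ k = c * y $ k" for k
    using eq[of k j] j by (simp add: c_def field_simps)
  ultimately show ?thesis
    by (intro exI[of _ c]) (simp add: vec_eq_iff)
qed

theorem theorem2p2:
  fixes g :: "complex ^ 'n::finite mod_ring"
  assumes "\<And>\<mu>. scalar_prod g (gabor g \<mu>) \<noteq> 0"
  shows "allows_phase_retrieval UNIV UNIV (gabor g)"
  unfolding allows_phase_retrieval_def
proof (intro ballI impI)
  fix x y :: "complex ^ 'n mod_ring"
  assume meas: "\<forall>\<mu>\<in>UNIV. (cmod (scalar_prod x (gabor g \<mu>)))\<^sup>2 = (cmod (scalar_prod y (gabor g \<mu>)))\<^sup>2"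
  define d where "d q k = x $ k * cnj (x $ (k + q)) - y $ k * cnj (y $ (k + q))" for q k
  define G where "G q r = cnj (g $ r) * g $ (r + q)" for q r
  have corr: "(\<Sum>k\<in>UNIV. d q k * G q (k - p)) = 0" for p q
  proof (rule fourier_injective[where d = "\<lambda>q. \<Sum>k\<in>UNIV. d q k * G q (k - p)"])
    fix l
    have "(of_real ((cmod (scalar_prod x (gabor g (p, l))))\<^sup>2) :: complex) =
        of_real ((cmod (scalar_prod y (gabor g (p, l))))\<^sup>2)"
      using meas by simp
    then show "(\<Sum>q\<in>UNIV. root_char (l * q) * (\<Sum>k\<in>UNIV. d q k * G q (k - p))) = 0"
      unfolding cmod_scalar_prod_gabor_square d_def G_def
      by (simp add: left_diff_distrib sum_subtractf right_diff_distrib)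
  qed
  \<comment> \<open>Since \<open>g\<^bsub>-q,m\<^esub>(r)\<close> is \<open>\<omega>\<^bsup>m r\<^esup> g(r + q)\<close>, this sum is \<open>\<langle>g, g\<^bsub>-q,m\<^esub>\<rangle>\<close>.\<close>
  have nz: "(\<Sum>r\<in>UNIV. root_char (m * r) * G q r) \<noteq> 0" for q m
    using assms[of "(- q, m)"] by (simp add: scalar_prod_gabor G_def mult_ac)
  have "d q k = 0" for q k
    using corr nz by (rule cross_correlation_injective)
  then have "x $ k * cnj (x $ j) = y $ k * cnj (y $ j)" for j k
    unfolding d_def by (metis add_diff_cancel_left' diff_add_cancel add.commute right_minus_eq)
  then show "\<exists>c. cmod c = 1 \<and> x = c *s y"
    by (rule rank_one_determines_vector)
qed

end
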